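(* Let $(A,\cdot,\alpha)$ be a Hom-algebra. Define $x\star y=x\cdot y+y\cdot x$ for $x,y\in A$, and let $L:A\to gl(A)$, $L(x)y=x\cdot y$, be the left multiplication operator. Then $(A,\cdot,\alpha)$ is a left Hom-pre-Jacobi-Jordan algebra if and only if $(A,\star,\alpha)$ is a Hom-Jacobi-Jordan algebra and $(A,L,\alpha)$ is a representation of $(A,\star,\alpha)$.
   Context: All vector spaces and algebras are over a ground field $\mathbb{K}$ of characteristic $0$; $gl(V)$ denotes the space of linear maps $V\to V$. A Hom-algebra is a triple $(A,\mu,\alpha)$ where $A$ is a vector space, $\alpha:A\to A$ is linear and $\mu$ is a bilinear product on $A$; it is multiplicative if $\alpha(\mu(x,y))=\mu(\alpha(x),\alpha(y))$ for all $x,y$. A Hom-Jacobi-Jordan algebra is a multiplicative Hom-algebra $(A,\ast,\alpha)$ such that $x\ast y=y\ast x$ and $(x\ast y)\ast\alpha(z)+(y\ast z)\ast\alpha(x)+(z\ast x)\ast\alpha(y)=0$ for all $x,y,z\in A$. A representation of a Hom-Jacobi-Jordan algebra $(A,\ast,\alpha)$ is a triple $(V,\rho,\phi)$ where $V$ is a vector space, $\phi\in gl(V)$, and $\rho:A\to gl(V)$ is a linear map such that for all $x,y\in A$: $\phi\rho(x)=\rho(\alpha(x))\phi$ and $\rho(x\ast y)\phi=-\rho(\alpha(x))\rho(y)-\rho(\alpha(y))\rho(x)$. The anti-Hom-associator of a Hom-algebra $(A,\cdot,\alpha)$ is $as^t_\alpha(x,y,z):=(x\cdot y)\cdot\alpha(z)+\alpha(x)\cdot(y\cdot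 z)$. A left Hom-pre-Jacobi-Jordan algebra is a multiplicative Hom-algebra $(A,\cdot,\alpha)$ with $as^t_\alpha(x,y,z)=-as^t_\alpha(y,x,z)$ for all $x,y,z\in A$. *)

theory Defs
  imports Complex_Main
begin

text \<open>
  The ground field is a type of class \<open>field_char_0\<close>; a vector space is a type of class
  \<open>ab_group_add\<close> with a scalar multiplication satisfying \<open>vector_space\<close>.
  An element of \<open>gl(V)\<close> is a function \<open>f\<close> with \<open>Vector_Spaces.linear s s f\<close>.
\<close>

locale hom_algebra = vector_space scale
  for scale :: "'k::field_char_0 \<Rightarrow> 'a::ab_group_add \<Rightarrow> 'a" +
  fixes mult :: "'a \<Rightarrow> 'a \<Rightarrow> 'a"
    and \<alpha> :: "'a \<Rightarrow> 'a"
  assumes linear_twist: "Vector_Spaces.linear scale scale \<alpha>"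
    and linear_mult_right: "Vector_Spaces.linear scale scale (\<lambda>y. mult x y)"
    and linear_mult_left: "Vector_Spaces.linear scale scale (\<lambda>x. mult x y)"

locale multiplicative_hom_algebra = hom_algebra scale mult \<alpha>
  for scale :: "'k::field_char_0 \<Rightarrow> 'a::ab_group_add \<Rightarrow> 'a"
    and mult :: "'a \<Rightarrow> 'a \<Rightarrow> 'a"
    and \<alpha> :: "'a \<Rightarrow> 'a" +
  assumes twist_mult: "\<alpha> (mult x y) = mult (\<alpha> x) (\<alpha> y)"

locale hom_jacobi_jordan_algebra = multiplicative_hom_algebra scale mult \<alpha>
  for scale :: "'k::field_char_0 \<Rightarrow> 'a::ab_group_add \<Rightarrow> 'a"
    and mult :: "'a \<Rightarrow> 'a \<Rightarrow> 'a"
    and \<alpha> :: "'a \<Rightarrow> 'a" +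
  assumes mult_commute: "mult x y = mult y x"
    and hom_jacobi:
      "mult (mult x y) (\<alpha> z) + mult (mult y z) (\<alpha> x) + mult (mult z x) (\<alpha> y) = 0"

locale hom_jacobi_jordan_representation =
  hom_jacobi_jordan_algebra scale mult \<alpha> + V: vector_space scaleV
  for scale :: "'k::field_char_0 \<Rightarrow> 'a::ab_group_add \<Rightarrow> 'a"
    and mult :: "'a \<Rightarrow> 'a \<Rightarrow> 'a"
    and \<alpha> :: "'a \<Rightarrow> 'a"
    and scaleV :: "'k \<Rightarrow> 'v::ab_group_add \<Rightarrow> 'v" +
  fixes \<rho> :: "'a \<Rightarrow> 'v \<Rightarrow> 'v"
    and \<phi> :: "'v \<Rightarrow> 'v"
  assumes linear_phi: "Vector_Spaces.linear scaleV scaleV \<phi>"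
    and rho_in_gl: "Vector_Spaces.linear scaleV scaleV (\<rho> x)"
    \<comment> \<open>linearity of \<open>\<rho>\<close> itself; the operations on \<open>gl(V)\<close> are pointwise\<close>
    and linear_rho: "Vector_Spaces.linear scale scaleV (\<lambda>x. \<rho> x v)"
    and phi_rho: "\<phi> \<circ> \<rho> x = \<rho> (\<alpha> x) \<circ> \<phi>"
    and rho_mult:
      "\<rho> (mult x y) \<circ> \<phi> = (\<lambda>v. - (\<rho> (\<alpha> x) \<circ> \<rho> y) v - (\<rho> (\<alpha> y) \<circ> \<rho> x) v)"

definition anti_hom_associator ::
  "('a::ab_group_add \<Rightarrow> 'a \<Rightarrow> 'a) \<Rightarrow> ('a \<Rightarrow> 'a) \<Rightarrow> 'a \<Rightarrow> 'a \<Rightarrow> 'a \<Rightarrow> 'a" where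
  "anti_hom_associator mult \<alpha> x y z = mult (mult x y) (\<alpha> z) + mult (\<alpha> x) (mult y z)"

locale left_hom_pre_jacobi_jordan_algebra = multiplicative_hom_algebra scale mult \<alpha>
  for scale :: "'k::field_char_0 \<Rightarrow> 'a::ab_group_add \<Rightarrow> 'a"
    and mult :: "'a \<Rightarrow> 'a \<Rightarrow> 'a"
    and \<alpha> :: "'a \<Rightarrow> 'a" +
  assumes anti_hom_associator_skew:
    "anti_hom_associator mult \<alpha> x y z = - anti_hom_associator mult \<alpha> y x z"

definition anticommutator ::
  "('a::ab_group_add \<Rightarrow> 'a \<Rightarrow> 'a) \<Rightarrow> 'a \<Rightarrow> 'a \<Rightarrow> 'a" where
  "anticommutator mult x y = mult x y + mult y x"

definition left_mult_op :: "('a \<Rightarrow> 'a \<Rightarrow> 'a) \<Rightarrow> 'a \<Rightarrow> 'a \<Rightarrow> 'a" where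
  "left_mult_op mult x = (\<lambda>y. mult x y)"

end

theory Submission
  imports Defs
begin

text \<open>
  Moving terms across the equation, skew-symmetry of the anti-Hom-associator in its first two
  arguments reads \<open>(x \<star> y) \<cdot> \<alpha> z = - \<alpha> x \<cdot> (y \<cdot> z) - \<alpha> y \<cdot> (x \<cdot> z)\<close>, which is the representation
  identity for \<open>L\<close> with respect to \<open>\<star>\<close> evaluated at \<open>z\<close>; likewise the compatibility
  \<open>\<alpha> \<circ> L x = L (\<alpha> x) \<circ> \<alpha>\<close> is multiplicativity of \<open>\<cdot>\<close>, and the
  linearity conditions are bilinearity of \<open>\<cdot>\<close>. So the representation axioms already contain
  the left Hom-pre-Jacobi-Jordan axioms, and the only further point is that these imply the
  Hom-Jacobi identity for \<open>\<star>\<close>. Substituting the displayed formula into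
  \<open>(x \<star> y) \<star> \<alpha> z = (x \<star> y) \<cdot> \<alpha> z + \<alpha> z \<cdot> (x \<star> y)\<close> leaves
  \<open>\<alpha> z \<cdot> (x \<cdot> y) - \<alpha> x \<cdot> (y \<cdot> z) + \<alpha> z \<cdot> (y \<cdot> x) - \<alpha> y \<cdot> (x \<cdot> z)\<close>,
  where each difference is that of a term and a cyclic shift of it, so the cyclic sum vanishes.
\<close>

text \<open>
  The left-hand side of the second equation collects the two terms \<open>(x \<cdot> y) \<cdot> \<alpha> z\<close> and
  \<open>(y \<cdot> x) \<cdot> \<alpha> z\<close> of the two associators, so additivity of the product in its left argument
  suffices. In this form the condition expresses how left multiplication by a \<open>\<star>\<close>-product acts,
  which is what a representation prescribes.
\<close>

lemma anti_hom_associator_skew_iff: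
  fixes mult :: "'a::ab_group_add \<Rightarrow> 'a \<Rightarrow> 'a"
  assumes "\<And>x x' y. mult (x + x') y = mult x y + mult x' y"
  shows "anti_hom_associator mult \<alpha> x y z = - anti_hom_associator mult \<alpha> y x z \<longleftrightarrow>
    mult (anticommutator mult x y) (\<alpha> z) = - mult (\<alpha> x) (mult y z) - mult (\<alpha> y) (mult x z)"
proof -
  have "anti_hom_associator mult \<alpha> x y z + anti_hom_associator mult \<alpha> y x z =
      mult (anticommutator mult x y) (\<alpha> z)
      - (- mult (\<alpha> x) (mult y z) - mult (\<alpha> y) (mult x z))"
    by (simp add: anti_hom_associator_def anticommutator_def assms)
  then show ?thesis
    by (metis eq_neg_iff_add_eq_0 right_minus_eq)
qed

context hom_algebra
begin

lemma mult_add_right: "mult x (y + z) = mult x y + mult x z"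
  using linear_mult_right[of x] by (simp add: Vector_Spaces.linear_iff)

lemma mult_add_left: "mult (x + y) z = mult x z + mult y z"
  using linear_mult_left[of z] by (simp add: Vector_Spaces.linear_iff)

lemma twist_add: "\<alpha> (x + y) = \<alpha> x + \<alpha> y"
  using linear_twist by (simp add: Vector_Spaces.linear_iff)

lemma hom_algebra_anticommutator: "hom_algebra scale (anticommutator mult) \<alpha>"
  (* Linearity of maps is itself a locale predicate, so unfolding locales here would go past the
     goals that the bilinearity facts match. *)
proof (intro hom_algebra.intro hom_algebra_axioms.intro vector_space_axioms)
  have lin: "Vector_Spaces.linear scale scale (\<lambda>y. mult x y + mult y x)" for x
    using linear_mult_right[of x] linear_mult_left[of x]
    by (simp add: Vector_Spaces.linear_iff scale_right_distrib algebra_simps)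
  show "Vector_Spaces.linear scale scale (\<lambda>y. anticommutator mult x y)" for x
    using lin by (simp add: anticommutator_def)
  show "Vector_Spaces.linear scale scale (\<lambda>x. anticommutator mult x y)" for y
    using lin[of y] by (simp add: anticommutator_def add.commute)
  show "Vector_Spaces.linear scale scale \<alpha>"
    by (fact linear_twist)
qed

end

context left_hom_pre_jacobi_jordan_algebra
begin

lemma anticommutator_mult_twist:
  "mult (anticommutator mult x y) (\<alpha> z) = - mult (\<alpha> x) (mult y z) - mult (\<alpha> y) (mult x z)"
  using anti_hom_associator_skew
  by (rule iffD1[OF anti_hom_associator_skew_iff[where mult = mult, OF mult_add_left]])

lemma hom_jacobi_jordan_anticommutator:
  "hom_jacobi_jordan_algebra scale (anticommutator mult) \<alpha>"
proof -
  interpret S: hom_algebra scale "anticommutator mult" \<alpha>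
    by (rule hom_algebra_anticommutator)
  show ?thesis
  proof unfold_locales
    fix x y z
    show "\<alpha> (anticommutator mult x y) = anticommutator mult (\<alpha> x) (\<alpha> y)"
      by (simp add: anticommutator_def twist_add twist_mult)
    show "anticommutator mult x y = anticommutator mult y x"
      by (simp add: anticommutator_def add.commute)
    have expand: "anticommutator mult (anticommutator mult u v) (\<alpha> w) =
        - mult (\<alpha> u) (mult v w) - mult (\<alpha> v) (mult u w)
        + mult (\<alpha> w) (mult u v) + mult (\<alpha> w) (mult v u)" for u v w
    proof -
      have "anticommutator mult (anticommutator mult u v) (\<alpha> w) =
          mult (anticommutator mult u v) (\<alpha> w) + mult (\<alpha> w) (anticommutator mult u v)"
        by (simp only: anticommutator_def[of mult "anticommutator mult u v"])
      also have "mult (\<alpha> w) (anticommutator mult u v) =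
          mult (\<alpha> w) (mult u v) + mult (\<alpha> w) (mult v u)"
        by (simp add: anticommutator_def mult_add_right)
      finally show ?thesis
        by (simp add: anticommutator_mult_twist add.assoc)
    qed
    (* The first and third, and the second and fourth, terms of the expansion are cyclic shifts
       of one another, so they cancel in the cyclic sum. *)
    show "anticommutator mult (anticommutator mult x y) (\<alpha> z)
        + anticommutator mult (anticommutator mult y z) (\<alpha> x)
        + anticommutator mult (anticommutator mult z x) (\<alpha> y) = 0"
      by (simp add: expand algebra_simps)
  qed
qed

lemma left_mult_op_representation:
  "hom_jacobi_jordan_representation scale (anticommutator mult) \<alpha> scale (left_mult_op mult) \<alpha>"
proof -
  interpret S: hom_jacobi_jordan_algebra scale "anticommutator mult" \<alpha>
    by (rule hom_jacobi_jordan_anticommutator)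
  show ?thesis
    by (intro hom_jacobi_jordan_representation.intro hom_jacobi_jordan_representation_axioms.intro
        S.hom_jacobi_jordan_algebra_axioms vector_space_axioms)
      (simp_all add: left_mult_op_def linear_twist linear_mult_right linear_mult_left
        fun_eq_iff twist_mult anticommutator_mult_twist)
qed

end

lemma left_hom_pre_jacobi_jordan_of_representation:
  assumes "hom_algebra scale mult \<alpha>"
    and "hom_jacobi_jordan_representation scale (anticommutator mult) \<alpha> scale
      (left_mult_op mult) \<alpha>"
  shows "left_hom_pre_jacobi_jordan_algebra scale mult \<alpha>"
proof -
  interpret hom_algebra scale mult \<alpha> by fact
  interpret R: hom_jacobi_jordan_representation scale "anticommutator mult" \<alpha> scale
    "left_mult_op mult" \<alpha> by fact
  show ?thesis
  proof unfold_locales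
    fix x y z
    show "\<alpha> (mult x y) = mult (\<alpha> x) (\<alpha> y)"
      using R.phi_rho[of x] by (simp add: left_mult_op_def fun_eq_iff)
    have "mult (anticommutator mult x y) (\<alpha> z) =
        - mult (\<alpha> x) (mult y z) - mult (\<alpha> y) (mult x z)"
      using R.rho_mult[of x y] by (simp add: left_mult_op_def fun_eq_iff)
    then show "anti_hom_associator mult \<alpha> x y z = - anti_hom_associator mult \<alpha> y x z"
      by (rule iffD2[OF anti_hom_associator_skew_iff[where mult = mult, OF mult_add_left]])
  qed
qed

theorem proposition4p7:
  fixes scale :: "'k::field_char_0 \<Rightarrow> 'a::ab_group_add \<Rightarrow> 'a"
    and mult :: "'a \<Rightarrow> 'a \<Rightarrow> 'a"
    and \<alpha> :: "'a \<Rightarrow> 'a"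
  assumes "hom_algebra scale mult \<alpha>"
  shows "left_hom_pre_jacobi_jordan_algebra scale mult \<alpha> \<longleftrightarrow>
    hom_jacobi_jordan_algebra scale (anticommutator mult) \<alpha> \<and>
    hom_jacobi_jordan_representation scale (anticommutator mult) \<alpha> scale (left_mult_op mult) \<alpha>"
  using left_hom_pre_jacobi_jordan_algebra.hom_jacobi_jordan_anticommutator
    left_hom_pre_jacobi_jordan_algebra.left_mult_op_representation
    left_hom_pre_jacobi_jordan_of_representation[OF assms]
  by blast

end
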